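(* Let $(\mathcal{X},\mathcal{Y},\{W(y|x):x\in\mathcal{X},y\in\mathcal{Y}\})$ be an output symmetric discrete memoryless channel with capacity $C$ and channel dispersion $\nu>0$, and let $T$ be a positive integer. Any sequence of $(n,M_n,\epsilon_n,T,S_n)$-streaming codes such that $\log M_n=nC-n^{1-t}$ and $S_n=\omega(n^t)$ for $0<t<\frac13$ satisfies $$\limsup_{n\to\infty}-\frac{1}{n^{1-2t}}\log\epsilon_n\le\frac{T}{2\nu}.$$
   Context: Conventions: all logs are to base 2. $[i:j]=\{i,i+1,\dots,j\}$; $x^j=(x_1,\dots,x_j)$. Asymptotic notation $\omega(\cdot)$ is the usual one, with the additional restriction that the sequences in it are positive. Channel: $\mathcal{X},\mathcal{Y}$ are finite sets and $W(\cdot|x)$ is a probability distribution on $\mathcal{Y}$ for each $x\in\mathcal{X}$. Channel uses are memoryless, without feedback. The channel is output symmetric (Gallager) if $\mathcal{Y}$ can be partitioned into disjoint subsets in such a way that for each subset the matrix of transition probabilities (rows indexed by $\mathcal{X}$, columns by the outputs in the subset) has the property that each row is a permutation of each other row and each column is a permutation of each other column. For a distribution $P$ on $\mathcal{X}$, let $PW(y)=\sum_x P(x)W(y|x)$, $i(x;y)=\log\frac{W(y|x)}{PW(y)}$, $I(P,W)=\sum_{x,y}P(x)W(y|x)\,i(x;y)$, and $V(P,W)=\mathrm{E}[\mathrm{Var}[i(X;Y)|X]]$ with $X\sim P$, $Y|X\sim W$. Capacity: $C=\max_P I(P,W)$. Dispersion: $\nu=\min_{P:I(P,W)=C}V(P,W)$.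 Streaming code: an $(n,M,\epsilon,T,S)$-streaming code consists of (i) independent messages $G_1,\dots,G_S$, each uniform on $\mathcal{G}=[1:M]$; (ii) encoding functions $\phi_k:\mathcal{G}^{\min\{k,S\}}\to\mathcal{X}^n$, $k\in[1:S+T-1]$, giving the codeword $\mathbf{X}_k=\phi_k(G^{\min\{k,S\}})$ sent in block $k$ ($n$ channel uses), with output $\mathbf{Y}_k\in\mathcal{Y}^n$; (iii) decoding functions $\psi_k:\mathcal{Y}^{(k+T-1)n}\to\mathcal{G}$, $k\in[1:S]$, giving $\hat G_k=\psi_k(\mathbf{Y}_1,\dots,\mathbf{Y}_{k+T-1})$; such that $\max_{k\in[1:S]}\Pr(\hat G_k\ne G_k)\le\epsilon$.
   Formalization: The bound is T/(2ν)·log_b e for logs to any base b>1, as T/(2ν) fails in base 2: for a BSC with T=1, good block codes attain log₂e/(2ν); b=e gives the printed bound. The size log M_n = nC − n^{1−t} is read up to rounding M_n to an adjacent integer. *)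

theory Defs
  imports
    "HOL-Probability.Probability"
    "HOL-Library.Landau_Symbols"
    "HOL-Library.Disjoint_Sets"
begin

text \<open>A channel with input alphabet \<open>'x\<close> and output alphabet \<open>'y\<close> (both finite) is a family
  \<open>W\<close> of output distributions, \<open>pmf (W x) y\<close> being \<open>W(y|x)\<close>. The output distribution \<open>PW\<close>
  is \<open>bind_pmf P W\<close>.

  All logarithms are to the same base \<open>b > 1\<close>; \<open>b = 2\<close> measures information in bits. Changing
  the base rescales capacity and dispersion, but the moderate deviation constant
  \<open>T / (2 \<nu>)\<close> of an error exponent is correct without a further factor only for the natural
  logarithm. To base \<open>b\<close> it is \<open>T / (2 \<nu>) * log b e\<close>, where \<open>e = exp 1\<close>. This factor cannot be
  dropped for \<open>b = 2\<close>: for a binary symmetric channel with crossover probability strictly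
  between 0 and 1/2, and \<open>T = 1\<close>, good block codes attain \<open>log 2 e / (2 \<nu>) > 1 / (2 \<nu>)\<close>.\<close>

definition output_symmetric :: "('x::finite \<Rightarrow> 'y::finite pmf) \<Rightarrow> bool" where
  "output_symmetric W \<longleftrightarrow>
    (\<exists>\<P>. partition_on UNIV \<P> \<and>
      (\<forall>B\<in>\<P>.
        (\<forall>x x'. \<exists>\<pi>. bij_betw \<pi> B B \<and> (\<forall>y\<in>B. pmf (W x') y = pmf (W x) (\<pi> y))) \<and>
        (\<forall>y\<in>B. \<forall>y'\<in>B. \<exists>\<sigma>. bij \<sigma> \<and> (\<forall>x. pmf (W x) y' = pmf (W (\<sigma> x)) y))))"

text \<open>The value at a pair with \<open>W(y|x) = 0\<close> is irrelevant: below it always carries weight zero.\<close>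

definition info_density :: "real \<Rightarrow> 'x pmf \<Rightarrow> ('x::finite \<Rightarrow> 'y::finite pmf) \<Rightarrow> 'x \<Rightarrow> 'y \<Rightarrow> real" where
  "info_density b P W x y = log b (pmf (W x) y / pmf (bind_pmf P W) y)"

definition mutual_info :: "real \<Rightarrow> 'x pmf \<Rightarrow> ('x::finite \<Rightarrow> 'y::finite pmf) \<Rightarrow> real" where
  "mutual_info b P W = (\<Sum>x\<in>UNIV. \<Sum>y\<in>UNIV. pmf P x * pmf (W x) y * info_density b P W x y)"

definition cond_info_variance :: "real \<Rightarrow> 'x pmf \<Rightarrow> ('x::finite \<Rightarrow> 'y::finite pmf) \<Rightarrow> real" where
  "cond_info_variance b P W =
    measure_pmf.expectation P (\<lambda>x. measure_pmf.variance (W x) (info_density b P W x))"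

text \<open>Both extrema are attained, by continuity on the compact set of input distributions.\<close>

definition capacity :: "real \<Rightarrow> ('x::finite \<Rightarrow> 'y::finite pmf) \<Rightarrow> real" where
  "capacity b W = (SUP P. mutual_info b P W)"

definition dispersion :: "real \<Rightarrow> ('x::finite \<Rightarrow> 'y::finite pmf) \<Rightarrow> real" where
  "dispersion b W = (INF P\<in>{P. mutual_info b P W = capacity b W}. cond_info_variance b P W)"

text \<open>Output of the memoryless channel for a finite input sequence.\<close>

primrec channel_output :: "('x \<Rightarrow> 'y pmf) \<Rightarrow> 'x list \<Rightarrow> 'y list pmf" where
  "channel_output W [] = return_pmf []"
| "channel_output W (x # xs) =
    bind_pmf (W x) (\<lambda>y. map_pmf ((#) y) (channel_output W xs))"

definition tuples :: "'a set \<Rightarrow> nat \<Rightarrow> 'a list set" where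
  "tuples A m = {xs. set xs \<subseteq> A \<and> length xs = m}"

text \<open>The message sequence \<open>(G\<^sub>1, \<dots>, G\<^sub>S)\<close> is a list \<open>g\<close> with \<open>G\<^sub>k = g ! (k - 1)\<close>; the codewords
  of the blocks \<open>1, \<dots>, S + T - 1\<close> are concatenated.\<close>

definition stream_codeword ::
    "nat \<Rightarrow> nat \<Rightarrow> (nat \<Rightarrow> nat list \<Rightarrow> 'x list) \<Rightarrow> nat list \<Rightarrow> 'x list" where
  "stream_codeword T S \<phi> g = concat (map (\<lambda>k. \<phi> k (take (min k S) g)) [1..<S + T])"

definition stream_pmf ::
    "('x \<Rightarrow> 'y pmf) \<Rightarrow> nat \<Rightarrow> nat \<Rightarrow> nat \<Rightarrow> (nat \<Rightarrow> nat list \<Rightarrow> 'x list) \<Rightarrow> (nat list \<times> 'y list) pmf"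
  where
  "stream_pmf W M T S \<phi> =
    bind_pmf (replicate_pmf S (pmf_of_set {1..M})) (\<lambda>g.
      map_pmf (Pair g) (channel_output W (stream_codeword T S \<phi> g)))"

definition stream_error ::
    "('x \<Rightarrow> 'y pmf) \<Rightarrow> nat \<Rightarrow> nat \<Rightarrow> nat \<Rightarrow> nat \<Rightarrow>
     (nat \<Rightarrow> nat list \<Rightarrow> 'x list) \<Rightarrow> (nat \<Rightarrow> 'y list \<Rightarrow> nat) \<Rightarrow> nat \<Rightarrow> real" where
  "stream_error W n M T S \<phi> \<psi> k =
    measure_pmf.prob (stream_pmf W M T S \<phi>)
      {(g, y). \<psi> k (take ((k + T - 1) * n) y) \<noteq> g ! (k - 1)}"

definition streaming_code ::
    "('x \<Rightarrow> 'y pmf) \<Rightarrow> nat \<Rightarrow> nat \<Rightarrow> real \<Rightarrow> nat \<Rightarrow> nat \<Rightarrow>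
     (nat \<Rightarrow> nat list \<Rightarrow> 'x list) \<Rightarrow> (nat \<Rightarrow> 'y list \<Rightarrow> nat) \<Rightarrow> bool" where
  "streaming_code W n M \<epsilon> T S \<phi> \<psi> \<longleftrightarrow>
    M \<ge> 1 \<and> T \<ge> 1 \<and> S \<ge> 1 \<and>
    (\<forall>k\<in>{1..S + T - 1}. \<phi> k \<in> tuples {1..M} (min k S) \<rightarrow> tuples UNIV n) \<and>
    (\<forall>k\<in>{1..S}. \<psi> k \<in> tuples UNIV ((k + T - 1) * n) \<rightarrow> {1..M}) \<and>
    (MAX k\<in>{1..S}. stream_error W n M T S \<phi> \<psi> k) \<le> \<epsilon>"

text \<open>The logarithm of an error probability of zero is \<open>- \<infinity>\<close>; \<open>log b 0 = 0\<close> would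
  make its exponent vanish.\<close>

definition neg_log :: "real \<Rightarrow> real \<Rightarrow> ereal" where
  "neg_log b \<epsilon> = (if \<epsilon> \<le> 0 then \<infinity> else ereal (- log b \<epsilon>))"

text \<open>\<open>log b M = r\<close> up to rounding of \<open>b powr r\<close> to an adjacent integer (down or up), since
  \<open>b powr r\<close> need not be an integer; the exact equation is a special case.\<close>

definition log_size :: "real \<Rightarrow> nat \<Rightarrow> real \<Rightarrow> bool" where
  "log_size b M r \<longleftrightarrow> \<bar>real M - b powr r\<bar> < 1"

end

theory Submission
  imports Defs "HOL-Real_Asymp.Real_Asymp"
begin

text \<open>Work in nats. Let \<open>q\<close> be the output distribution of the uniform input and \<open>j(x,y)\<close> the centred
  information density \<open>ln (W(y|x)/q(y)) - C\<close>; by symmetry its mean \<open>0\<close> and variance \<open>v\<close> under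
  \<open>W(\<cdot>|x)\<close> do not depend on \<open>x\<close>. The tilted channel \<open>V = W (1 - s j)\<close> satisfies
  \<open>D(V(\<cdot>|x) \<parallel> q) \<le> C - s v + s\<^sup>2 v\<close>, so for \<open>s\<close> slightly larger than \<open>n\<^sup>-\<^sup>t ln b / v\<close> it
  cannot support the rate of the code. Since \<open>S\<close> grows faster than \<open>n\<^sup>t\<close>, the \<open>T - 1\<close> surplus
  blocks are negligible, and for some \<open>k\<close> the message \<open>G\<^sub>k\<close> is decoded wrongly with probability
  at least of order \<open>n\<^sup>-\<^sup>t\<close> when the \<open>T\<close> blocks \<open>k, \<dots>, k + T - 1\<close> are sent over \<open>V\<close> and
  the preceding ones over \<open>W\<close>. Changing the measure
  from \<open>V\<close> to \<open>W\<close> in these \<open>n T\<close> channel uses costs a factor \<open>exp (- n T s\<^sup>2 v / 2)\<close>, up to a factor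
  \<open>1 + o(1)\<close> in the exponent.

  Fano's inequality is replaced by the variational formula for relative entropy
  (\<open>E\<^sub>P f \<le> D(P \<parallel> Q) + ln (E\<^sub>Q (exp f))\<close>), applied to the number of correctly decoded messages times
  \<open>ln M\<close>; under \<open>Q\<close> the output is independent of the messages.\<close>

section \<open>Expectations over finitely supported distributions\<close>

abbreviation expect :: "'a pmf \<Rightarrow> ('a \<Rightarrow> real) \<Rightarrow> real" where
  "expect \<equiv> measure_pmf.expectation"

lemma expect_bind:
  assumes "finite (set_pmf p)" "\<And>x. x \<in> set_pmf p \<Longrightarrow> finite (set_pmf (f x))"
  shows "expect (bind_pmf p f) h = expect p (\<lambda>x. expect (f x) h)"
  using assms by (subst pmf_expectation_bind[of "set_pmf p"]) (auto simp: integral_measure_pmf[of "set_pmf p"])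

lemma expect_swap:
  assumes "finite (set_pmf p)" "finite (set_pmf q)"
  shows "expect p (\<lambda>x. expect q (f x)) = expect q (\<lambda>y. expect p (\<lambda>x. f x y))"
proof -
  have "expect p (\<lambda>x. expect q (f x)) = (\<Sum>x\<in>set_pmf p. \<Sum>y\<in>set_pmf q. pmf p x * (pmf q y * f x y))"
    using assms by (subst integral_measure_pmf[of "set_pmf p"];
        simp add: integral_measure_pmf[of "set_pmf q"] sum_distrib_left)
  also have "\<dots> = (\<Sum>y\<in>set_pmf q. \<Sum>x\<in>set_pmf p. pmf p x * (pmf q y * f x y))"
    by (rule sum.swap)
  also have "\<dots> = expect q (\<lambda>y. expect p (\<lambda>x. f x y))"
    using assms by (subst integral_measure_pmf[of "set_pmf q"];
        simp add: integral_measure_pmf[of "set_pmf p"] sum_distrib_left mult_ac)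
  finally show ?thesis .
qed

lemma expect_mono:
  assumes "finite (set_pmf p)" "\<And>x. x \<in> set_pmf p \<Longrightarrow> f x \<le> g x"
  shows "expect p f \<le> expect p g"
  using assms by (intro integral_mono_AE) (auto simp: integrable_measure_pmf_finite AE_measure_pmf_iff)

lemma expect_cong:
  assumes "\<And>x. x \<in> set_pmf p \<Longrightarrow> f x = g x"
  shows "expect p f = expect p g"
  using assms by (intro integral_cong_AE) (auto simp: AE_measure_pmf_iff)

lemma expect_nonneg:
  assumes "\<And>x. x \<in> set_pmf p \<Longrightarrow> 0 \<le> f x"
  shows "0 \<le> expect p f"
  using assms by (intro integral_nonneg_AE) (auto simp: AE_measure_pmf_iff)

lemma finite_set_replicate_pmf:
  "finite (set_pmf p) \<Longrightarrow> finite (set_pmf (replicate_pmf S p))"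
  by (induction S) auto

text \<open>Given the prefix \<open>take i g\<close>, the entry \<open>g ! i\<close> still has law
  \<open>p\<close>, so each factor contributes at most \<open>B\<close> in conditional mean. The
  induction peels off the first entry and moves it into the history argument of \<open>D\<close>,
  which is why \<open>D\<close> varies.\<close>

lemma expect_replicate_pmf_prod_le:
  fixes D :: "'a list \<Rightarrow> 'a \<Rightarrow> real"
  assumes "finite (set_pmf p)" "\<And>h m. 0 \<le> D h m" "\<And>h. expect p (D h) \<le> B"
  shows "expect (replicate_pmf S p) (\<lambda>g. \<Prod>i<S. D (take i g) (g ! i)) \<le> B ^ S"
  using assms(2,3)
proof (induction S arbitrary: D)
  case 0
  then show ?case by simp
next
  case (Suc S)
  note fin = finite_set_replicate_pmf[OF assms(1)]
  have B: "B \<ge> 0"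
    using Suc.prems(2)[of "[]"] by (rule order_trans[rotated]) (intro expect_nonneg Suc.prems)
  have "expect (replicate_pmf (Suc S) p) (\<lambda>g. \<Prod>i<Suc S. D (take i g) (g ! i))
    = expect p (\<lambda>m. D [] m * expect (replicate_pmf S p) (\<lambda>g. \<Prod>i<S. D (m # take i g) (g ! i)))"
    using fin assms(1)
    by (simp add: expect_bind prod.lessThan_Suc_shift map_pmf_def[symmetric] del: prod.lessThan_Suc)
  also have "\<dots> \<le> expect p (\<lambda>m. D [] m * B ^ S)"
    using Suc.prems assms(1) by (intro expect_mono mult_left_mono Suc.IH[where D="\<lambda>h. D (_ # h)"]) auto
  also have "\<dots> = expect p (D []) * B ^ S" by simp
  also have "\<dots> \<le> B * B ^ S"
    using B Suc.prems by (intro mult_right_mono) auto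
  finally show ?case by simp
qed

section \<open>Memoryless channels\<close>

lemma finite_set_channel_output [simp]:
  fixes W :: "'x \<Rightarrow> 'y::finite pmf"
  shows "finite (set_pmf (channel_output W xs))"
  by (induction xs) auto

lemma length_channel_output:
  "ys \<in> set_pmf (channel_output W xs) \<Longrightarrow> length ys = length xs"
  by (induction xs arbitrary: ys) auto

lemma expect_channel_output_Cons:
  fixes W :: "'x \<Rightarrow> 'y::finite pmf"
  shows "expect (channel_output W (x # xs)) f
    = (\<Sum>y\<in>UNIV. pmf (W x) y * expect (channel_output W xs) (\<lambda>ys. f (y # ys)))"
  by (simp, subst pmf_expectation_bind[of UNIV]) auto

lemma expect_channel_output_append:
  fixes W :: "'x \<Rightarrow> 'y::finite pmf"
  shows "expect (channel_output W (xs @ ys)) f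
    = expect (channel_output W xs) (\<lambda>u. expect (channel_output W ys) (\<lambda>v. f (u @ v)))"
proof (induction xs arbitrary: f)
  case (Cons x xs)
  show ?case
    unfolding append_Cons expect_channel_output_Cons Cons.IH ..
qed simp

lemma expect_channel_output_segment:
  fixes W :: "'x \<Rightarrow> 'y::finite pmf"
  shows "expect (channel_output W (xs @ ys @ zs)) (\<lambda>v. f (take (length ys) (drop (length xs) v)))
    = expect (channel_output W ys) f"
proof -
  have "expect (channel_output W (xs @ ys @ zs)) (\<lambda>v. f (take (length ys) (drop (length xs) v)))
     = expect (channel_output W xs) (\<lambda>_.
         expect (channel_output W ys) (\<lambda>u. expect (channel_output W zs) (\<lambda>_. f u)))"
    unfolding expect_channel_output_append
    by (intro expect_cong) (auto dest!: length_channel_output)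
  then show ?thesis by simp
qed

text \<open>This expresses that the reference output carries no information on the messages: all
  codewords have the same length.\<close>

lemma channel_output_const:
  "length xs = length xs' \<Longrightarrow> channel_output (\<lambda>_. q) xs = channel_output (\<lambda>_. q) xs'"
  by (induction xs xs' rule: list_induct2) auto

text \<open>The variational formula for relative entropy, with ln z replaced by its tangent bound ln
  c - 1 + z / c. This form is linear in the exponential moment, so it can be averaged over the
  messages before that moment is estimated.\<close>

lemma expect_channel_output_le_divergence:
  fixes V :: "'x \<Rightarrow> 'y::finite pmf"
  assumes ac: "\<And>x y. pmf q y = 0 \<Longrightarrow> pmf (V x) y = 0"
    and D: "\<And>x. (\<Sum>y\<in>UNIV. pmf (V x) y * ln (pmf (V x) y / pmf q y)) \<le> D"
    and c: "c > 0"
  shows "expect (channel_output V xs) f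
    \<le> real (length xs) * D + ln c - 1 + expect (channel_output (\<lambda>_. q) xs) (\<lambda>ys. exp (f ys)) / c"
  using c
proof (induction xs arbitrary: f c)
  case Nil
  have "ln (exp (f []) / c) \<le> exp (f []) / c - 1"
    using Nil by (intro ln_le_minus_one) simp
  then show ?case using Nil by (simp add: ln_div)
next
  case (Cons x xs)
  define R where "R y = expect (channel_output (\<lambda>_. q) xs) (\<lambda>ys. exp (f (y # ys)))" for y
  have R: "R y \<ge> 0" for y
    unfolding R_def by (intro expect_nonneg) simp
  define v where "v y = pmf (V x) y" for y
  have v_sum: "(\<Sum>y\<in>UNIV. v y) = 1"
    unfolding v_def by (intro sum_pmf_eq_1) auto
  \<comment> \<open>the induction hypothesis is used with the constant \<open>c V(y|x) / q(y)\<close>, which depends on \<open>y\<close>\<close>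
  have *: "v y * expect (channel_output V xs) (\<lambda>ys. f (y # ys))
    \<le> v y * (real (length xs) * D + ln c - 1) + v y * ln (v y / pmf q y) + pmf q y * R y / c" for y
  proof (cases "v y = 0")
    case True
    then show ?thesis using R[of y] Cons.prems by simp
  next
    case False
    then have pos: "v y > 0" "pmf q y > 0"
      using ac[of y x] by (auto simp: v_def pmf_pos pmf_nonneg order_less_le)
    have "expect (channel_output V xs) (\<lambda>ys. f (y # ys))
      \<le> real (length xs) * D + ln (c * (v y / pmf q y)) - 1 + R y / (c * (v y / pmf q y))"
      unfolding R_def by (rule Cons.IH) (use pos Cons.prems in simp)
    also have "ln (c * (v y / pmf q y)) = ln c + ln (v y / pmf q y)"
      using pos Cons.prems by (intro ln_mult_pos) auto
    finally have "v y * expect (channel_output V xs) (\<lambda>ys. f (y # ys)) \<le>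
      v y * (real (length xs) * D + (ln c + ln (v y / pmf q y)) - 1 + R y / (c * (v y / pmf q y)))"
      using pos by (intro mult_left_mono) auto
    also have "\<dots> = v y * (real (length xs) * D + ln c - 1) + v y * ln (v y / pmf q y) + pmf q y * R y / c"
      using pos Cons.prems by (simp add: field_simps)
    finally show ?thesis .
  qed
  have "expect (channel_output V (x # xs)) f = (\<Sum>y\<in>UNIV. v y * expect (channel_output V xs) (\<lambda>ys. f (y # ys)))"
    by (simp only: expect_channel_output_Cons v_def)
  also have "\<dots> \<le> (\<Sum>y\<in>UNIV. v y * (real (length xs) * D + ln c - 1) + v y * ln (v y / pmf q y) + pmf q y * R y / c)"
    by (intro sum_mono *)
  also have "\<dots> = (\<Sum>y\<in>UNIV. v y) * (real (length xs) * D + ln c - 1)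
       + (\<Sum>y\<in>UNIV. v y * ln (v y / pmf q y)) + (\<Sum>y\<in>UNIV. pmf q y * R y) / c"
    by (simp only: sum.distrib sum_distrib_right sum_divide_distrib)
  also have "(\<Sum>y\<in>UNIV. pmf q y * R y) = expect (channel_output (\<lambda>_. q) (x # xs)) (\<lambda>ys. exp (f ys))"
    by (simp only: expect_channel_output_Cons R_def)
  finally show ?case
    using D[of x] v_sum by (simp add: v_def algebra_simps)
qed

text \<open>Where the likelihood ratio of \<open>V\<close> to \<open>W\<close> is at most
  \<open>L\<close>, passing to \<open>W\<close> costs a factor \<open>L\<close>; by Markov's
  inequality for its \<open>a\<close>-th power, the rest has \<open>V\<close>-probability at most
  \<open>L powr (- a)\<close> times a moment that factors over the letters.\<close>

lemma expect_channel_output_change_measure: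
  fixes V W :: "'x \<Rightarrow> 'y::finite pmf"
  assumes ac: "\<And>x y. pmf (W x) y = 0 \<Longrightarrow> pmf (V x) y = 0"
    and K: "\<And>x. (\<Sum>y\<in>UNIV. pmf (V x) y * (pmf (V x) y / pmf (W x) y) powr a) \<le> K"
    and f: "\<And>ys. 0 \<le> f ys" "\<And>ys. f ys \<le> 1"
    and "a > 0" "L > 0"
  shows "expect (channel_output V xs) f
    \<le> L * expect (channel_output W xs) f + L powr (- a) * K ^ length xs"
  using f \<open>L > 0\<close>
proof (induction xs arbitrary: f L)
  case Nil
  \<comment> \<open>Here \<open>L\<close> has become the original threshold divided by the
    likelihood ratio of the whole word, so the case split is the truncation of that ratio.\<close>
  have "f [] \<le> L * f [] + L powr (- a)"
  proof (cases "L \<ge> 1")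
    case True
    then have "1 * f [] \<le> L * f []" using Nil by (intro mult_right_mono)
    moreover have "L powr (-a) \<ge> 0" by simp
    ultimately show ?thesis by linarith
  next
    case False
    then have "L powr 0 \<le> L powr (-a)"
      using Nil \<open>a > 0\<close> by (intro powr_mono') auto
    then have "1 \<le> L powr (-a)" using Nil by simp
    moreover have "L * f [] \<ge> 0" using Nil by simp
    ultimately show ?thesis using Nil(2)[of "[]"] by linarith
  qed
  then show ?case by simp
next
  case (Cons x xs)
  define v w where "v y = pmf (V x) y" and "w y = pmf (W x) y" for y
  define R where "R y = expect (channel_output W xs) (\<lambda>ys. f (y # ys))" for y
  have R: "R y \<ge> 0" for y
    unfolding R_def using Cons.prems by (intro expect_nonneg) simp
  have K0: "K \<ge> 0"
    using K[of x] by (rule order_trans[rotated]) (intro sum_nonneg mult_nonneg_nonneg; simp)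
  \<comment> \<open>the induction hypothesis is used with the factor \<open>L W(y|x) / V(y|x)\<close>, which depends on \<open>y\<close>\<close>
  have *: "v y * expect (channel_output V xs) (\<lambda>ys. f (y # ys))
    \<le> L * (w y * R y) + L powr (- a) * K ^ length xs * (v y * (v y / w y) powr a)" for y
  proof (cases "v y = 0")
    case True
    then show ?thesis using R[of y] Cons.prems by (simp add: w_def)
  next
    case False
    then have pos: "v y > 0" "w y > 0"
      using ac[of x y] by (auto simp: v_def w_def pmf_pos pmf_nonneg order_less_le)
    have "expect (channel_output V xs) (\<lambda>ys. f (y # ys))
      \<le> (L * (w y / v y)) * R y + (L * (w y / v y)) powr (- a) * K ^ length xs"
      unfolding R_def by (rule Cons.IH) (use pos Cons.prems in simp_all)
    also have "(L * (w y / v y)) powr (- a) = L powr (- a) * (v y / w y) powr a"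
      using pos Cons.prems by (simp add: powr_mult powr_minus powr_divide field_simps)
    finally have "v y * expect (channel_output V xs) (\<lambda>ys. f (y # ys)) \<le>
      v y * ((L * (w y / v y)) * R y + L powr (- a) * (v y / w y) powr a * K ^ length xs)"
      using pos by (intro mult_left_mono) auto
    also have "\<dots> = L * (w y * R y) + L powr (- a) * K ^ length xs * (v y * (v y / w y) powr a)"
      using pos by (simp add: field_simps)
    finally show ?thesis .
  qed
  have "expect (channel_output V (x # xs)) f = (\<Sum>y\<in>UNIV. v y * expect (channel_output V xs) (\<lambda>ys. f (y # ys)))"
    by (simp only: expect_channel_output_Cons v_def)
  also have "\<dots> \<le> (\<Sum>y\<in>UNIV. L * (w y * R y) + L powr (- a) * K ^ length xs * (v y * (v y / w y) powr a))"
    by (intro sum_mono *)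
  also have "\<dots> = L * (\<Sum>y\<in>UNIV. w y * R y) + L powr (- a) * K ^ length xs * (\<Sum>y\<in>UNIV. v y * (v y / w y) powr a)"
    by (simp only: sum.distrib sum_distrib_left)
  also have "\<dots> \<le> L * (\<Sum>y\<in>UNIV. w y * R y) + L powr (- a) * K ^ length xs * K"
    using K[of x] K0 by (intro add_left_mono mult_left_mono) (auto simp: v_def w_def)
  also have "(\<Sum>y\<in>UNIV. w y * R y) = expect (channel_output W (x # xs)) f"
    by (simp only: expect_channel_output_Cons R_def w_def)
  finally show ?case by (simp add: mult_ac)
qed

section \<open>A converse for streaming codes at fixed block length\<close>

lemma prob_eq_expect: "measure_pmf.prob p A = expect p (\<lambda>x. of_bool (x \<in> A))"
proof -
  have "measure_pmf.prob p A = expect p (indicator A)" by simp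
  also have "\<dots> = expect p (\<lambda>x. of_bool (x \<in> A))"
    by (intro expect_cong) (simp add: indicator_def)
  finally show ?thesis .
qed

lemma length_concat_map_const:
  "(\<And>j. j \<in> set js \<Longrightarrow> length (f j) = n) \<Longrightarrow> length (concat (map f js)) = length js * n"
  by (induction js) auto

text \<open>Both sides bound the expected reward, \<open>ln M\<close> per decoded message, when
  every block is sent over \<open>V\<close>: from below by the error guarantee and a change of
  measure over the \<open>T * n\<close> letters of one decoding window, from above by relative
  entropy to \<open>q\<close>. The \<open>ln 2\<close> per message plays the part of the entropy
  term in Fano's inequality.\<close>

lemma streaming_converse:
  fixes W V :: "'x \<Rightarrow> 'y::finite pmf"
  assumes code: "streaming_code W n M \<epsilon> T S \<phi> \<psi>"
    and ac: "\<And>x y. pmf q y = 0 \<Longrightarrow> pmf (V x) y = 0"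
    and D: "\<And>x. (\<Sum>y\<in>UNIV. pmf (V x) y * ln (pmf (V x) y / pmf q y)) \<le> D"
    and acW: "\<And>x y. pmf (W x) y = 0 \<Longrightarrow> pmf (V x) y = 0"
    and K: "\<And>x. (\<Sum>y\<in>UNIV. pmf (V x) y * (pmf (V x) y / pmf (W x) y) powr a) \<le> K"
    and a: "a > 0" and L: "L > 0"
  shows "real S * (ln (real M) * (1 - L * \<epsilon> - L powr (- a) * K ^ (T * n)))
    \<le> real ((S + T - 1) * n) * D + real S * ln 2"
proof -
  define block where "block g k = \<phi> k (take (min k S) g)" for g k
  define past where "past k g = concat (map (block g) [1..<k])" for k g
  define now where "now k g = concat (map (block g) [k..<k + T])" for k g
  define cw where "cw g = concat (map (block g) [1..<S + T])" for g
  define U where "U = replicate_pmf S (pmf_of_set {1..M})"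
  define N where "N = (S + T - 1) * n"
  define seg where "seg k Y = take (T * n) (drop ((k - 1) * n) Y)" for k and Y :: "'y list"
  define \<tau> where "\<tau> = L powr (- a) * K ^ (T * n)"
  define err :: "nat \<Rightarrow> nat list \<Rightarrow> 'y list \<Rightarrow> 'y list \<Rightarrow> real"
    where "err k g u v = of_bool (\<psi> k (u @ v) \<noteq> g ! (k - 1))" for k g u v

  have M: "M \<ge> 1" and T: "T \<ge> 1" and S: "S \<ge> 1"
    and \<phi>: "\<And>k. k \<in> {1..S + T - 1} \<Longrightarrow> \<phi> k \<in> tuples {1..M} (min k S) \<rightarrow> tuples UNIV n"
    and \<epsilon>: "(MAX k\<in>{1..S}. stream_error W n M T S \<phi> \<psi> k) \<le> \<epsilon>"
    using code by (auto simp: streaming_code_def)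
  have finM: "finite (set_pmf (pmf_of_set {1..M}))"
    using M by (simp add: set_pmf_of_set)
  have finU [simp]: "finite (set_pmf U)"
    unfolding U_def by (intro finite_set_replicate_pmf finM)
  have setU: "set_pmf U \<subseteq> tuples {1..M} S"
    using M by (auto simp: U_def set_replicate_pmf tuples_def set_pmf_of_set)
  have len_block: "length (block g k) = n" if "g \<in> set_pmf U" "k \<in> {1..S + T - 1}" for g k
  proof -
    have "take (min k S) g \<in> tuples {1..M} (min k S)"
      using that setU set_take_subset[of "min k S" g] by (auto simp: tuples_def)
    then show ?thesis
      using \<phi>[OF that(2)] by (auto simp: block_def tuples_def)
  qed
  have len_past: "length (past k g) = (k - 1) * n" if "g \<in> set_pmf U" "k \<in> {1..S}" for g k
    unfolding past_def using that T
    by (subst length_concat_map_const[where n=n]) (auto intro!: len_block)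
  have len_now: "length (now k g) = T * n" if "g \<in> set_pmf U" "k \<in> {1..S}" for g k
    unfolding now_def using that T
    by (subst length_concat_map_const[where n=n]) (auto intro!: len_block)
  have len_cw: "length (cw g) = N" if "g \<in> set_pmf U" for g
    unfolding cw_def N_def using that T
    by (subst length_concat_map_const[where n=n]) (auto intro!: len_block)
  have cw_split: "cw g = past k g @ now k g @ concat (map (block g) [k + T..<S + T])"
    if "k \<in> {1..S}" for g k
  proof -
    have "[1..<S + T] = [1..<k] @ [k..<k + T] @ [k + T..<S + T]"
      using that upt_add_eq_append[of 1 k "S + T - k"] upt_add_eq_append[of k "k + T" "S - k"] by (simp add: add.commute)
    then show ?thesis by (simp only: cw_def past_def now_def map_append concat_append)
  qed
  \<comment> \<open>Causality of the encoder: blocks before \<open>k\<close> involve only the first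
    \<open>k - 1\<close> messages, so a decoder that knows these can simulate the past.\<close>
  have past_take: "past k g = past k (take (k - 1) g)" if "k \<in> {1..S}" for g k
    unfolding past_def block_def using that
    by (intro arg_cong[where f=concat] map_cong refl arg_cong2[where f=\<phi>]) (auto simp: min_def)

  have stream_err: "expect U (\<lambda>g. expect (channel_output W (past k g)) (\<lambda>u.
      expect (channel_output W (now k g)) (err k g u))) \<le> \<epsilon>" if k: "k \<in> {1..S}" for k
  proof -
    have "stream_error W n M T S \<phi> \<psi> k
        = expect U (\<lambda>g. expect (channel_output W (cw g))
            (\<lambda>Y. of_bool (\<psi> k (take ((k + T - 1) * n) Y) \<noteq> g ! (k - 1))))"
      unfolding stream_error_def stream_pmf_def stream_codeword_def U_def[symmetric]
      unfolding prob_eq_expect by (auto simp: expect_bind cw_def block_def[abs_def])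
    also have "\<dots> = expect U (\<lambda>g. expect (channel_output W (past k g)) (\<lambda>u.
      expect (channel_output W (now k g)) (err k g u)))"
    proof (intro expect_cong)
      fix g assume g: "g \<in> set_pmf U"
      have len: "(k + T - 1) * n = length (past k g) + length (now k g)"
        using k T by (simp add: len_past[OF g k] len_now[OF g k] add_mult_distrib[symmetric])
      show "expect (channel_output W (cw g)) (\<lambda>Y. of_bool (\<psi> k (take ((k + T - 1) * n) Y) \<noteq> g ! (k - 1)))
        = expect (channel_output W (past k g)) (\<lambda>u. expect (channel_output W (now k g)) (err k g u))"
        unfolding cw_split[OF k] expect_channel_output_append len
      proof (intro expect_cong, goal_cases)
        case (1 u v)
        have "expect (channel_output W (concat (map (block g) [k + T..<S + T])))
          (\<lambda>va. of_bool (\<psi> k (take (length (past k g) + length (now k g)) (u @ v @ va)) \<noteq> g ! (k - 1)))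
          = expect (channel_output W (concat (map (block g) [k + T..<S + T]))) (\<lambda>_. err k g u v)"
          using 1 by (intro expect_cong) (auto simp: err_def dest!: length_channel_output)
        then show ?case by simp
      qed
    qed
    finally have "stream_error W n M T S \<phi> \<psi> k = \<dots>" .
    moreover have "stream_error W n M T S \<phi> \<psi> k \<le> \<epsilon>"
      using k by (intro order_trans[OF Max_ge \<epsilon>]) auto
    ultimately show ?thesis by (metis (no_types))
  qed

  \<comment> \<open>The past stays under \<open>W\<close>, so the cost of the change of measure does
    not grow with \<open>k\<close>.\<close>
  have mixed_err: "expect U (\<lambda>g. expect (channel_output W (past k g)) (\<lambda>u.
      expect (channel_output V (now k g)) (err k g u))) \<le> L * \<epsilon> + \<tau>" if k: "k \<in> {1..S}" for k
  proof -
    have "expect U (\<lambda>g. expect (channel_output W (past k g)) (\<lambda>u.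
        expect (channel_output V (now k g)) (err k g u)))
      \<le> expect U (\<lambda>g. expect (channel_output W (past k g)) (\<lambda>u.
        L * expect (channel_output W (now k g)) (err k g u) + \<tau>))"
    proof (intro expect_mono finU finite_set_channel_output)
      fix g u assume g: "g \<in> set_pmf U"
      show "expect (channel_output V (now k g)) (err k g u)
        \<le> L * expect (channel_output W (now k g)) (err k g u) + \<tau>"
        using expect_channel_output_change_measure[OF acW K, where f="err k g u" and xs="now k g" and L=L] a L
        by (simp add: len_now[OF g k] \<tau>_def err_def)
    qed
    also have "\<dots> = L * expect U (\<lambda>g. expect (channel_output W (past k g)) (\<lambda>u.
      expect (channel_output W (now k g)) (err k g u))) + \<tau>"
      by (simp add: integrable_measure_pmf_finite)
    finally show ?thesis
      using mult_left_mono[OF stream_err[OF k], of L] L by linarith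
  qed

  \<comment> \<open>A randomized decoder of \<open>G\<^sub>k\<close> that knows the past messages \<open>h\<close>: \<open>d k h m v\<close> is the
    probability of its output \<open>m\<close>. It simulates the past outputs with \<open>W\<close>, so that it looks only at
    the blocks \<open>k, \<dots>, k + T - 1\<close>.\<close>
  define d where "d k h m v = expect (channel_output W (past k h)) (\<lambda>u. of_bool (\<psi> k (u @ v) = m))"
    for k h m v
  have d01: "0 \<le> d k h m v" "d k h m v \<le> 1" for k h m v
  proof -
    show "0 \<le> d k h m v" unfolding d_def by (intro expect_nonneg) simp
    have "d k h m v \<le> expect (channel_output W (past k h)) (\<lambda>_. 1)"
      unfolding d_def by (intro expect_mono) auto
    then show "d k h m v \<le> 1" by simp
  qed
  define f where "f g Y = (\<Sum>k\<in>{1..S}. ln (real M) * d k (take (k - 1) g) (g ! (k - 1)) (seg k Y))" for g Y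

  \<comment> \<open>The decoder ignores the actual past, which now comes from \<open>V\<close>, and
    draws its own from \<open>W\<close>. Its input therefore has exactly the mixed law of
    \<open>mixed_err\<close>.\<close>
  have success: "expect U (\<lambda>g. expect (channel_output V (cw g))
      (\<lambda>Y. d k (take (k - 1) g) (g ! (k - 1)) (seg k Y))) \<ge> 1 - L * \<epsilon> - \<tau>"
    if k: "k \<in> {1..S}" for k
  proof -
    have "expect U (\<lambda>g. expect (channel_output V (cw g))
        (\<lambda>Y. d k (take (k - 1) g) (g ! (k - 1)) (seg k Y)))
      = expect U (\<lambda>g. 1 - expect (channel_output W (past k g)) (\<lambda>u.
      expect (channel_output V (now k g)) (err k g u)))"
    proof (intro expect_cong)
      fix g assume g: "g \<in> set_pmf U"
      have "expect (channel_output V (cw g)) (\<lambda>Y. d k (take (k - 1) g) (g ! (k - 1)) (seg k Y))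
        = expect (channel_output V (now k g)) (d k (take (k - 1) g) (g ! (k - 1)))"
        unfolding cw_split[OF k] seg_def len_past[OF g k, symmetric] len_now[OF g k, symmetric]
        by (rule expect_channel_output_segment)
      also have "\<dots> = expect (channel_output V (now k g)) (\<lambda>v.
          expect (channel_output W (past k g)) (\<lambda>u. 1 - err k g u v))"
        unfolding d_def past_take[OF k, symmetric] err_def by (intro expect_cong) auto
      also have "\<dots> = expect (channel_output W (past k g)) (\<lambda>u.
          expect (channel_output V (now k g)) (\<lambda>v. 1 - err k g u v))"
        by (rule expect_swap) auto
      also have "\<dots> = 1 - expect (channel_output W (past k g)) (\<lambda>u.
          expect (channel_output V (now k g)) (err k g u))"
        by (simp add: integrable_measure_pmf_finite)
      finally show "expect (channel_output V (cw g)) (\<lambda>Y. d k (take (k - 1) g) (g ! (k - 1)) (seg k Y)) = \<dots>" .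
    qed
    also have "\<dots> = 1 - expect U (\<lambda>g. expect (channel_output W (past k g)) (\<lambda>u.
      expect (channel_output V (now k g)) (err k g u)))"
      by (simp add: integrable_measure_pmf_finite)
    finally show ?thesis using mixed_err[OF k] by linarith
  qed

  \<comment> \<open>For a fixed output, each \<open>G_k\<close> is a fresh uniform message that a
    decoder hits with probability at most \<open>1 / M\<close>, even when it knows the earlier
    messages. The reward factor is \<open>M\<close> on a hit and 1 otherwise, hence its mean is at
    most 2.\<close>
  have guess: "expect U (\<lambda>g. exp (f g Y)) \<le> 2 ^ S" for Y
  proof -
    \<comment> \<open>The message index is recovered from the history as
      \<open>length h + 1\<close>, because list positions start at 0 and messages at 1.\<close>
    define B where "B h m = 1 + (real M - 1) * d (length h + 1) h m (seg (length h + 1) Y)" for h m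
    have B0: "0 \<le> B h m" for h m
      unfolding B_def using M d01 by (intro add_nonneg_nonneg mult_nonneg_nonneg) auto
    have B2: "expect (pmf_of_set {1..M}) (B h) \<le> 2" for h
    proof -
      let ?k = "length h + 1"
      have "(\<Sum>m\<in>{1..M}. d ?k h m (seg ?k Y))
        = expect (channel_output W (past ?k h)) (\<lambda>u. \<Sum>m\<in>{1..M}. of_bool (\<psi> ?k (u @ seg ?k Y) = m))"
        unfolding d_def by (subst Bochner_Integration.integral_sum) (auto simp: integrable_measure_pmf_finite)
      also have "\<dots> \<le> expect (channel_output W (past ?k h)) (\<lambda>u. 1)"
        by (intro expect_mono) (auto simp: of_bool_def)
      finally have *: "(\<Sum>m\<in>{1..M}. d ?k h m (seg ?k Y)) \<le> 1" by simp
      have "expect (pmf_of_set {1..M}) (B h) = (\<Sum>m\<in>{1..M}. B h m) / real M"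
        using M by (simp add: integral_pmf_of_set)
      also have "(\<Sum>m\<in>{1..M}. B h m) = real M + (real M - 1) * (\<Sum>m\<in>{1..M}. d ?k h m (seg ?k Y))"
        by (simp add: B_def sum.distrib sum_distrib_left)
      also have "\<dots> \<le> real M + (real M - 1) * 1"
        using * M by (intro add_left_mono mult_left_mono) auto
      also have "(real M + (real M - 1) * 1) / real M \<le> 2"
        using M by (simp add: field_simps)
      finally show ?thesis using M by (simp add: divide_right_mono)
    qed
    \<comment> \<open>The convex function M^x lies below its chord on [0, 1]; this handles the
      fractional rewards of a randomized decoder.\<close>
    have pow_le: "exp (ln (real M) * x) \<le> 1 + (real M - 1) * x" if "0 \<le> x" "x \<le> 1" for x
    proof -
      have "exp ((1 - x) *\<^sub>R 0 + x *\<^sub>R ln (real M)) \<le> (1 - x) * exp 0 + x * exp (ln (real M))"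
        using exp_convex that by (intro convex_onD) auto
      then show ?thesis using M by (simp add: algebra_simps)
    qed
    have "expect U (\<lambda>g. exp (f g Y)) \<le> expect U (\<lambda>g. \<Prod>i<S. B (take i g) (g ! i))"
    proof (intro expect_mono finU)
      fix g assume g: "g \<in> set_pmf U"
      then have [simp]: "length g = S" using setU by (auto simp: tuples_def)
      have "exp (f g Y) = (\<Prod>k\<in>{1..S}. exp (ln (real M) * d k (take (k - 1) g) (g ! (k - 1)) (seg k Y)))"
        unfolding f_def by (simp add: exp_sum)
      also have "\<dots> = (\<Prod>i<S. exp (ln (real M) * d (Suc i) (take i g) (g ! i) (seg (Suc i) Y)))"
        by (rule prod.reindex_bij_witness[of _ Suc "\<lambda>k. k - 1"]) auto
      also have "\<dots> \<le> (\<Prod>i<S. B (take i g) (g ! i))"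
        using d01 by (intro prod_mono) (auto simp: B_def intro!: pow_le)
      finally show "exp (f g Y) \<le> (\<Prod>i<S. B (take i g) (g ! i))" .
    qed
    also have "\<dots> \<le> 2 ^ S"
      unfolding U_def by (intro expect_replicate_pmf_prod_le finM B0 B2)
    finally show ?thesis .
  qed

  \<comment> \<open>The input word is a placeholder of length \<open>N\<close>. Below,
    \<open>c\<close> is \<open>2 ^ S\<close>, the bound in \<open>guess\<close>, so that once the
    two expectations are exchanged the exponential moment divided by \<open>c\<close> is at most 1
    and cancels the \<open>- 1\<close>.\<close>
  let ?q = "channel_output (\<lambda>_. q) (replicate N (undefined :: 'x))"
  have "real S * (ln (real M) * (1 - L * \<epsilon> - \<tau>))
      = (\<Sum>k\<in>{1..S}. ln (real M) * (1 - L * \<epsilon> - \<tau>))"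
    by simp
  also have "\<dots> \<le> (\<Sum>k\<in>{1..S}. ln (real M) * expect U (\<lambda>g. expect (channel_output V (cw g))
      (\<lambda>Y. d k (take (k - 1) g) (g ! (k - 1)) (seg k Y))))"
    using M by (intro sum_mono mult_left_mono success) auto
  also have "\<dots> = expect U (\<lambda>g. expect (channel_output V (cw g)) (f g))"
    unfolding f_def by (simp add: integrable_measure_pmf_finite)
  also have "\<dots> \<le> expect U (\<lambda>g. real N * D + ln (2 ^ S) - 1 + expect ?q (\<lambda>Y. exp (f g Y)) / 2 ^ S)"
  proof (intro expect_mono finU)
    fix g assume g: "g \<in> set_pmf U"
    show "expect (channel_output V (cw g)) (f g)
      \<le> real N * D + ln (2 ^ S) - 1 + expect ?q (\<lambda>Y. exp (f g Y)) / 2 ^ S"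
      using expect_channel_output_le_divergence[where V=V and q=q and D=D, OF ac D, where c="2 ^ S" and xs="cw g" and f="f g"]
        channel_output_const[of "cw g" "replicate N (undefined :: 'x)" q]
      by (simp add: len_cw[OF g])
  qed
  also have "\<dots> = real N * D + ln (2 ^ S) - 1 + expect U (\<lambda>g. expect ?q (\<lambda>Y. exp (f g Y))) / 2 ^ S"
    by (simp add: integrable_measure_pmf_finite)
  also have "expect U (\<lambda>g. expect ?q (\<lambda>Y. exp (f g Y))) = expect ?q (\<lambda>Y. expect U (\<lambda>g. exp (f g Y)))"
    by (rule expect_swap) auto
  also have "\<dots> \<le> expect ?q (\<lambda>_. 2 ^ S)"
    by (intro expect_mono guess) auto
  finally show ?thesis
    by (simp add: N_def \<tau>_def ln_realpow divide_right_mono)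
qed

section \<open>Tilted channels and the information density\<close>

text \<open>The second-order Taylor coefficient is \<open>d * (1 + d) / 2\<close>; the extra factor
  \<open>1 + d\<close> absorbs the remainder for small \<open>u\<close>.\<close>

lemma one_minus_powr_upper_bound:
  fixes d :: real
  assumes "d > 0"
  obtains h where "0 < h" "h < 1"
    "\<And>u. \<bar>u\<bar> \<le> h \<Longrightarrow> (1 - u) powr (1 + d) \<le> 1 - (1 + d) * u + d * (1 + d)\<^sup>2 / 2 * u\<^sup>2"
proof -
  have "((\<lambda>u::real. ((1 - u) powr (1 + d) - 1 + (1 + d) * u) / u\<^sup>2) \<longlongrightarrow> d * (1 + d) / 2) (at 0)"
    using assms by real_asymp
  moreover have "d * (1 + d) / 2 < d * (1 + d)\<^sup>2 / 2"
    using assms by (simp add: power2_eq_square)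
  ultimately have "\<forall>\<^sub>F u in at 0. ((1 - u) powr (1 + d) - 1 + (1 + d) * u) / u\<^sup>2 < d * (1 + d)\<^sup>2 / 2"
    by (rule order_tendstoD)
  then obtain e where e: "e > 0"
    "\<And>u. u \<noteq> 0 \<Longrightarrow> \<bar>u\<bar> < e \<Longrightarrow> ((1 - u) powr (1 + d) - 1 + (1 + d) * u) / u\<^sup>2 < d * (1 + d)\<^sup>2 / 2"
    by (auto simp: eventually_at dist_real_def)
  show thesis
  proof (rule that[of "min (e / 2) (1 / 2)"])
    fix u assume u: "\<bar>u\<bar> \<le> min (e / 2) (1 / 2)"
    show "(1 - u) powr (1 + d) \<le> 1 - (1 + d) * u + d * (1 + d)\<^sup>2 / 2 * u\<^sup>2"
    proof (cases "u = 0")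
      case False
      then show ?thesis using e(2)[of u] u \<open>e > 0\<close> by (simp add: divide_less_eq)
    qed simp
  qed (use \<open>e > 0\<close> in auto)
qed

text \<open>A linearised exponential tilting by \<open>- s * j\<close>; since \<open>j\<close> is
  centred, no normalising constant is required.\<close>

lemma tilted_channel:
  fixes W :: "'x::finite \<Rightarrow> 'y::finite pmf"
  assumes "\<And>x. (\<Sum>y\<in>UNIV. pmf (W x) y * j x y) = 0" "\<And>x y. s * j x y < 1"
  obtains V where "\<And>x y. pmf (V x) y = pmf (W x) y * (1 - s * j x y)"
proof -
  have "pmf (embed_pmf (\<lambda>y. pmf (W x) y * (1 - s * j x y))) y = pmf (W x) y * (1 - s * j x y)" for x y
  proof (rule pmf_embed_pmf)
    show nonneg: "0 \<le> pmf (W x) y * (1 - s * j x y)" for y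
      using assms(2)[of x y] by simp
    have "(\<Sum>y\<in>UNIV. pmf (W x) y * (1 - s * j x y))
      = (\<Sum>y\<in>UNIV. pmf (W x) y) - s * (\<Sum>y\<in>UNIV. pmf (W x) y * j x y)"
      by (simp add: algebra_simps sum_subtractf sum_distrib_left)
    also have "(\<Sum>y\<in>UNIV. pmf (W x) y) = 1" by (intro sum_pmf_eq_1) auto
    finally show "(\<integral>\<^sup>+ y. ennreal (pmf (W x) y * (1 - s * j x y)) \<partial>count_space UNIV) = 1"
      using nonneg assms(1) by (simp add: nn_integral_count_space_finite)
  qed
  then show thesis by (rule that)
qed

text \<open>After \<open>ln (1 - s * j) \<le> - s * j\<close> the integrand is quadratic in
  \<open>j\<close>, so mean and variance determine the bound.\<close>

lemma tilted_channel_divergence_le: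
  fixes W V :: "'x::finite \<Rightarrow> 'y::finite pmf"
  assumes j: "\<And>x y. j x y = ln (pmf (W x) y / pmf q y) - m"
    and mean: "(\<Sum>y\<in>UNIV. pmf (W x) y * j x y) = 0"
    and var: "(\<Sum>y\<in>UNIV. pmf (W x) y * (j x y)\<^sup>2) = v"
    and ac: "\<And>y. pmf q y = 0 \<Longrightarrow> pmf (W x) y = 0"
    and s: "\<And>y. s * j x y < 1"
    and V: "\<And>y. pmf (V x) y = pmf (W x) y * (1 - s * j x y)"
  shows "(\<Sum>y\<in>UNIV. pmf (V x) y * ln (pmf (V x) y / pmf q y)) \<le> m - s * v + s\<^sup>2 * v"
proof -
  have "pmf (V x) y * ln (pmf (V x) y / pmf q y)
    \<le> m * pmf (W x) y + (1 - s - s * m) * (pmf (W x) y * j x y) + (s\<^sup>2 - s) * (pmf (W x) y * (j x y)\<^sup>2)" for y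
  proof (cases "pmf (W x) y = 0")
    case False
    then have pos: "pmf (W x) y > 0" "pmf q y > 0" "1 - s * j x y > 0"
      using ac[of y] s[of y] by (auto simp: pmf_pos pmf_nonneg order_less_le)
    have "ln (pmf (V x) y / pmf q y) = ln ((pmf (W x) y / pmf q y) * (1 - s * j x y))"
      by (simp add: V)
    also have "\<dots> = ln (pmf (W x) y / pmf q y) + ln (1 - s * j x y)"
      using pos by (intro ln_mult_pos) auto
    also have "\<dots> \<le> (j x y + m) - s * j x y"
      using ln_le_minus_one[OF pos(3)] by (simp add: j)
    finally have "pmf (V x) y * ln (pmf (V x) y / pmf q y)
      \<le> (pmf (W x) y * (1 - s * j x y)) * ((j x y + m) - s * j x y)"
      unfolding V using pos by (intro mult_left_mono) auto
    also have "\<dots> = m * pmf (W x) y + (1 - s - s * m) * (pmf (W x) y * j x y)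
        + (s\<^sup>2 - s) * (pmf (W x) y * (j x y)\<^sup>2)"
      by (simp add: algebra_simps power2_eq_square)
    finally show ?thesis .
  qed (simp add: V)
  then have "(\<Sum>y\<in>UNIV. pmf (V x) y * ln (pmf (V x) y / pmf q y))
    \<le> (\<Sum>y\<in>UNIV. m * pmf (W x) y + (1 - s - s * m) * (pmf (W x) y * j x y) + (s\<^sup>2 - s) * (pmf (W x) y * (j x y)\<^sup>2))"
    by (intro sum_mono)
  also have "\<dots> = m * (\<Sum>y\<in>UNIV. pmf (W x) y) + (1 - s - s * m) * (\<Sum>y\<in>UNIV. pmf (W x) y * j x y)
      + (s\<^sup>2 - s) * (\<Sum>y\<in>UNIV. pmf (W x) y * (j x y)\<^sup>2)"
    by (simp only: sum.distrib sum_distrib_left)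
  also have "(\<Sum>y\<in>UNIV. pmf (W x) y) = 1" by (intro sum_pmf_eq_1) auto
  finally show ?thesis unfolding mean var by (simp add: algebra_simps)
qed

text \<open>The summand equals \<open>W * (1 - s * j) powr (1 + d)\<close>. In the mean of its
  quadratic bound the linear term vanishes, and 1 + z is at most exp z.\<close>

lemma tilted_channel_moment_le:
  fixes W V :: "'x::finite \<Rightarrow> 'y::finite pmf"
  assumes mean: "(\<Sum>y\<in>UNIV. pmf (W x) y * j x y) = 0"
    and var: "(\<Sum>y\<in>UNIV. pmf (W x) y * (j x y)\<^sup>2) = v"
    and s: "\<And>y. \<bar>s * j x y\<bar> \<le> h"
    and h: "h < 1" "\<And>u. \<bar>u\<bar> \<le> h \<Longrightarrow> (1 - u) powr (1 + d) \<le> 1 - (1 + d) * u + d * (1 + d)\<^sup>2 / 2 * u\<^sup>2"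
    and V: "\<And>y. pmf (V x) y = pmf (W x) y * (1 - s * j x y)"
  shows "(\<Sum>y\<in>UNIV. pmf (V x) y * (pmf (V x) y / pmf (W x) y) powr d) \<le> exp (d * (1 + d)\<^sup>2 * (s\<^sup>2 * v / 2))"
proof -
  have "pmf (V x) y * (pmf (V x) y / pmf (W x) y) powr d
    \<le> pmf (W x) y - (1 + d) * s * (pmf (W x) y * j x y)
      + d * (1 + d)\<^sup>2 / 2 * s\<^sup>2 * (pmf (W x) y * (j x y)\<^sup>2)" for y
  proof (cases "pmf (W x) y = 0")
    case False
    have pos: "1 - s * j x y > 0" using s[of y] h(1) by linarith
    have "pmf (V x) y * (pmf (V x) y / pmf (W x) y) powr d = pmf (W x) y * (1 - s * j x y) powr (1 + d)"
      using False pos by (simp add: V powr_add)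
    also have "\<dots> \<le> pmf (W x) y * (1 - (1 + d) * (s * j x y) + d * (1 + d)\<^sup>2 / 2 * (s * j x y)\<^sup>2)"
      by (intro mult_left_mono h s) simp
    finally show ?thesis by (simp add: algebra_simps power2_eq_square)
  qed (simp add: V)
  then have "(\<Sum>y\<in>UNIV. pmf (V x) y * (pmf (V x) y / pmf (W x) y) powr d)
    \<le> (\<Sum>y\<in>UNIV. pmf (W x) y - (1 + d) * s * (pmf (W x) y * j x y)
      + d * (1 + d)\<^sup>2 / 2 * s\<^sup>2 * (pmf (W x) y * (j x y)\<^sup>2))"
    by (intro sum_mono)
  also have "\<dots> = (\<Sum>y\<in>UNIV. pmf (W x) y) - (1 + d) * s * (\<Sum>y\<in>UNIV. pmf (W x) y * j x y)
      + d * (1 + d)\<^sup>2 / 2 * s\<^sup>2 * (\<Sum>y\<in>UNIV. pmf (W x) y * (j x y)\<^sup>2)"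
    by (simp only: sum.distrib sum_subtractf sum_distrib_left)
  also have "(\<Sum>y\<in>UNIV. pmf (W x) y) = 1" by (intro sum_pmf_eq_1) auto
  also have "1 - (1 + d) * s * (\<Sum>y\<in>UNIV. pmf (W x) y * j x y)
      + d * (1 + d)\<^sup>2 / 2 * s\<^sup>2 * (\<Sum>y\<in>UNIV. pmf (W x) y * (j x y)\<^sup>2)
    = 1 + d * (1 + d)\<^sup>2 * (s\<^sup>2 * v / 2)"
    by (simp add: mean var)
  also have "\<dots> \<le> exp (d * (1 + d)\<^sup>2 * (s\<^sup>2 * v / 2))" by (rule exp_ge_add_one_self)
  finally show ?thesis .
qed

text \<open>Column permutations make \<open>q\<close> constant on each class of the partition. The
  permutation of a class that carries one row to another thus preserves \<open>q\<close>, and the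
  sums agree by reindexing. The function \<open>F\<close> covers both the mean and the variance of
  the information density.\<close>

lemma output_symmetric_pmf_uniform_eq:
  fixes W :: "'x::finite \<Rightarrow> 'y::finite pmf" and F :: "real \<Rightarrow> real \<Rightarrow> real"
  defines "q \<equiv> bind_pmf (pmf_of_set UNIV) W"
  assumes "output_symmetric W"
  shows "(\<Sum>y\<in>UNIV. F (pmf (W x) y) (pmf q y)) = (\<Sum>y\<in>UNIV. F (pmf (W x') y) (pmf q y))"
proof -
  obtain P where P: "partition_on UNIV P"
    and perm: "\<And>B x x'. B \<in> P \<Longrightarrow> \<exists>\<pi>. bij_betw \<pi> B B \<and> (\<forall>y\<in>B. pmf (W x') y = pmf (W x) (\<pi> y))"
    and cols: "\<And>B y y'. B \<in> P \<Longrightarrow> y \<in> B \<Longrightarrow> y' \<in> B \<Longrightarrow> \<exists>\<sigma>. bij \<sigma> \<and> (\<forall>x. pmf (W x) y' = pmf (W (\<sigma> x)) y)"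
    using assms(2) unfolding output_symmetric_def by metis
  have q: "pmf q y = (\<Sum>x\<in>UNIV. pmf (W x) y) / real CARD('x)" for y
    unfolding q_def by (subst pmf_bind_pmf_of_set) auto
  have q_const: "pmf q y' = pmf q y" if B: "B \<in> P" "y \<in> B" "y' \<in> B" for B y y'
  proof -
    obtain \<sigma> where \<sigma>: "bij \<sigma>" "\<And>x. pmf (W x) y' = pmf (W (\<sigma> x)) y" using cols[OF B] by auto
    have "(\<Sum>x\<in>UNIV. pmf (W (\<sigma> x)) y) = (\<Sum>x\<in>UNIV. pmf (W x) y)"
      by (rule sum.reindex_bij_betw[OF \<sigma>(1), of "\<lambda>x. pmf (W x) y"])
    then show ?thesis by (simp add: q \<sigma>(2))
  qed
  have split: "(\<Sum>y\<in>UNIV. F (pmf (W x) y) (pmf q y)) = (\<Sum>B\<in>P. \<Sum>y\<in>B. F (pmf (W x) y) (pmf q y))" for x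
    using P sum.Union_disjoint[of P "\<lambda>y. F (pmf (W x) y) (pmf q y)"]
    by (auto simp: partition_on_def disjoint_def)
  have "(\<Sum>y\<in>B. F (pmf (W x) y) (pmf q y)) = (\<Sum>y\<in>B. F (pmf (W x') y) (pmf q y))" if B: "B \<in> P" for B
  proof -
    obtain \<pi> where \<pi>: "bij_betw \<pi> B B" "\<And>y. y \<in> B \<Longrightarrow> pmf (W x') y = pmf (W x) (\<pi> y)"
      using perm[OF B] by blast
    have "(\<Sum>y\<in>B. F (pmf (W x') y) (pmf q y)) = (\<Sum>y\<in>B. F (pmf (W x) (\<pi> y)) (pmf q (\<pi> y)))"
    proof (intro sum.cong refl arg_cong2[where f=F])
      fix y assume y: "y \<in> B"
      then have "\<pi> y \<in> B" using \<pi>(1) by (rule bij_betw_apply[rotated])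
      then show "pmf q y = pmf q (\<pi> y)" using q_const[OF B _ y] by blast
    qed (use \<pi> in auto)
    also have "\<dots> = (\<Sum>y\<in>B. F (pmf (W x) y) (pmf q y))"
      by (rule sum.reindex_bij_betw[OF \<pi>(1), of "\<lambda>y. F (pmf (W x) y) (pmf q y)"])
    finally show ?thesis ..
  qed
  then show ?thesis unfolding split by (rule sum.cong[OF refl])
qed


text \<open>The uniform input attains capacity: as the mean \<open>m\<close> does not depend on
  \<open>x\<close>, the information of any \<open>P\<close> is \<open>m\<close> minus the divergence
  of its output law from \<open>q\<close>, in nats. Dispersion is an infimum over capacity-achieving
  inputs, hence at most the value at the uniform one.\<close>

lemma output_symmetric_info_density:
  fixes W :: "'x::finite \<Rightarrow> 'y::finite pmf"
  assumes "b > 1" "output_symmetric W"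
  obtains q j v where
    "\<And>x y. pmf q y = 0 \<Longrightarrow> pmf (W x) y = 0"
    "\<And>x y. j x y = ln (pmf (W x) y / pmf q y) - ln b * capacity b W"
    "\<And>x. (\<Sum>y\<in>UNIV. pmf (W x) y * j x y) = 0"
    "\<And>x. (\<Sum>y\<in>UNIV. pmf (W x) y * (j x y)\<^sup>2) = v"
    "dispersion b W \<le> v / (ln b)\<^sup>2"
proof -
  define U where "U = pmf_of_set (UNIV :: 'x set)"
  define q where "q = bind_pmf U W"
  define x0 where "x0 = (undefined :: 'x)"
  define i where "i x y = ln (pmf (W x) y / pmf q y)" for x y
  define m where "m = (\<Sum>y\<in>UNIV. pmf (W x0) y * i x0 y)"
  define v where "v = (\<Sum>y\<in>UNIV. pmf (W x0) y * (i x0 y - m)\<^sup>2)"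
  have lnb: "ln b > 0" using assms by simp
  have sumW: "(\<Sum>y\<in>UNIV. pmf (W x) y) = 1" for x
    by (intro sum_pmf_eq_1) auto
  have q: "pmf q y = (\<Sum>x\<in>UNIV. pmf (W x) y) / real CARD('x)" for y
    unfolding q_def U_def by (subst pmf_bind_pmf_of_set) auto
  have ac: "pmf (W x) y = 0" if "pmf q y = 0" for x y
    using that by (simp add: q sum_nonneg_eq_0_iff)
  have m: "(\<Sum>y\<in>UNIV. pmf (W x) y * i x y) = m" for x
    unfolding m_def i_def q_def U_def
    by (rule output_symmetric_pmf_uniform_eq[OF assms(2), where F="\<lambda>w r. w * ln (w / r)"])
  have v: "(\<Sum>y\<in>UNIV. pmf (W x) y * (i x y - m)\<^sup>2) = v" for x
    unfolding v_def i_def q_def U_def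
    by (rule output_symmetric_pmf_uniform_eq[OF assms(2), where F="\<lambda>w r. w * (ln (w / r) - m)\<^sup>2"])
  have info: "info_density b U W x y = i x y / ln b" for x y
    by (simp add: info_density_def log_def i_def q_def)
  have inner: "(\<Sum>y\<in>UNIV. pmf P x * pmf (W x) y * (i x y / ln b)) = pmf P x * (m / ln b)" for P x
    by (simp add: m[of x, symmetric] sum_distrib_left sum_divide_distrib mult_ac)
  have sumP: "(\<Sum>x\<in>UNIV. pmf P x) = 1" for P :: "'x pmf"
    by (intro sum_pmf_eq_1) auto
  have U: "mutual_info b U W = m / ln b"
    unfolding mutual_info_def info inner by (simp only: sum_distrib_right[symmetric] sumP mult_1)
  have bound: "mutual_info b P W \<le> m / ln b" for P
  proof -
    define r where "r = bind_pmf P W"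
    have r: "pmf r y = (\<Sum>x\<in>UNIV. pmf P x * pmf (W x) y)" for y
      unfolding r_def pmf_bind by (subst integral_measure_pmf[of UNIV]) auto
    have "pmf P x * pmf (W x) y * info_density b P W x y
      \<le> pmf P x * pmf (W x) y * (i x y / ln b)
        + (pmf P x * pmf (W x) y * (pmf q y / pmf r y) - pmf P x * pmf (W x) y) / ln b" for x y
    proof (cases "pmf P x * pmf (W x) y = 0")
      case False
      then have pos: "pmf P x > 0" "pmf (W x) y > 0"
        by (auto simp: pmf_pos pmf_nonneg order_less_le)
      then have "pmf r y > 0" "pmf q y > 0"
        using ac[of y x] member_le_sum[of x UNIV "\<lambda>x. pmf P x * pmf (W x) y"]
        by (auto simp: r pmf_pos pmf_nonneg order_less_le mult_le_0_iff sum_nonneg)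
      note pos = pos this
      have "ln (pmf (W x) y / pmf r y) = i x y + ln (pmf q y / pmf r y)"
        using pos by (simp add: i_def ln_div)
      also have "\<dots> \<le> i x y + (pmf q y / pmf r y - 1)"
        using pos by (intro add_left_mono ln_le_minus_one) simp
      finally have "pmf P x * pmf (W x) y * ln (pmf (W x) y / pmf r y)
        \<le> pmf P x * pmf (W x) y * (i x y + (pmf q y / pmf r y - 1))"
        using pos by (intro mult_left_mono) auto
      then have "pmf P x * pmf (W x) y * ln (pmf (W x) y / pmf r y) / ln b
        \<le> pmf P x * pmf (W x) y * (i x y + (pmf q y / pmf r y - 1)) / ln b"
        using lnb by (intro divide_right_mono) auto
      then show ?thesis
        by (simp add: info_density_def log_def r_def[symmetric] algebra_simps add_divide_distrib diff_divide_distrib)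
    qed auto
    then have "mutual_info b P W \<le> (\<Sum>x\<in>UNIV. \<Sum>y\<in>UNIV. pmf P x * pmf (W x) y * (i x y / ln b)
        + (pmf P x * pmf (W x) y * (pmf q y / pmf r y) - pmf P x * pmf (W x) y) / ln b)"
      unfolding mutual_info_def by (intro sum_mono)
    also have "\<dots> = (\<Sum>x\<in>UNIV. \<Sum>y\<in>UNIV. pmf P x * pmf (W x) y * (i x y / ln b))
        + ((\<Sum>x\<in>UNIV. \<Sum>y\<in>UNIV. pmf P x * pmf (W x) y * (pmf q y / pmf r y))
          - (\<Sum>x\<in>UNIV. \<Sum>y\<in>UNIV. pmf P x * pmf (W x) y)) / ln b"
      by (simp only: sum.distrib sum_subtractf sum_divide_distrib[symmetric])
    also have "(\<Sum>x\<in>UNIV. \<Sum>y\<in>UNIV. pmf P x * pmf (W x) y * (i x y / ln b)) = m / ln b"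
      unfolding inner by (simp only: sum_distrib_right[symmetric] sumP mult_1)
    also have "(\<Sum>x\<in>UNIV. \<Sum>y\<in>UNIV. pmf P x * pmf (W x) y) = 1"
      by (simp only: sum_distrib_left[symmetric] sumW sumP mult_1_right)
    also have "(\<Sum>x\<in>UNIV. \<Sum>y\<in>UNIV. pmf P x * pmf (W x) y * (pmf q y / pmf r y))
      = (\<Sum>y\<in>UNIV. pmf r y * (pmf q y / pmf r y))"
      by (subst sum.swap) (simp only: r sum_distrib_right[symmetric])
    \<comment> \<open>Where \<open>pmf r y = 0\<close> the summand is 0 instead of
      \<open>pmf q y\<close>, so this is an inequality.\<close>
    also have "m / ln b + ((\<Sum>y\<in>UNIV. pmf r y * (pmf q y / pmf r y)) - 1) / ln b
      \<le> m / ln b + ((\<Sum>y\<in>UNIV. pmf q y) - 1) / ln b"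
      using lnb by (intro add_left_mono divide_right_mono diff_right_mono sum_mono) auto
    also have "(\<Sum>y\<in>UNIV. pmf q y) = 1" by (intro sum_pmf_eq_1) auto
    finally show ?thesis by simp
  qed
  have cap: "capacity b W = m / ln b"
    unfolding capacity_def
  proof (rule cSup_eq_maximum)
    show "m / ln b \<in> range (\<lambda>P. mutual_info b P W)" using U by (metis rangeI)
  qed (use bound in auto)
  have mean_x: "measure_pmf.expectation (W x) (info_density b U W x) = m / ln b" for x
    by (subst integral_measure_pmf[of UNIV]) (auto simp: info m[symmetric, of x] sum_divide_distrib)
  have var_x: "measure_pmf.variance (W x) (info_density b U W x) = v / (ln b)\<^sup>2" for x
    unfolding mean_x
    by (subst integral_measure_pmf[of UNIV])
      (auto simp: info v[symmetric, of x] sum_divide_distrib power_divide diff_divide_distrib[symmetric])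
  have "dispersion b W \<le> cond_info_variance b U W"
    unfolding dispersion_def
  proof (rule cINF_lower)
    show "bdd_below ((\<lambda>P. cond_info_variance b P W) ` {P. mutual_info b P W = capacity b W})"
      by (rule bdd_belowI2[of _ 0]) (auto simp: cond_info_variance_def intro!: Bochner_Integration.integral_nonneg)
  qed (simp add: U cap)
  also have "\<dots> = v / (ln b)\<^sup>2"
    by (simp add: cond_info_variance_def var_x)
  finally have disp: "dispersion b W \<le> v / (ln b)\<^sup>2" .
  have cap': "ln b * capacity b W = m" using lnb by (simp add: cap)
  show thesis
  proof (rule that[of q "\<lambda>x y. i x y - m" v])
    show "(\<Sum>y\<in>UNIV. pmf (W x) y * (i x y - m)) = 0" for x
      using m[of x] sumW[of x] by (simp add: right_diff_distrib sum_subtractf sum_distrib_right[symmetric])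
  qed (use ac v disp in \<open>auto simp: cap' i_def\<close>)
qed

text \<open>The divergence of a tilted channel from \<open>q\<close> is nonnegative, which gives
  \<open>m \<ge> s * (1 - s) * v\<close> for small \<open>s\<close>.\<close>

lemma info_mean_pos:
  fixes W :: "'x::finite \<Rightarrow> 'y::finite pmf"
  assumes ac: "\<And>x y. pmf q y = 0 \<Longrightarrow> pmf (W x) y = 0"
    and j: "\<And>x y. j x y = ln (pmf (W x) y / pmf q y) - m"
    and mean: "\<And>x. (\<Sum>y\<in>UNIV. pmf (W x) y * j x y) = 0"
    and var: "\<And>x. (\<Sum>y\<in>UNIV. pmf (W x) y * (j x y)\<^sup>2) = v"
    and J: "\<And>x y. \<bar>j x y\<bar> \<le> J" and v: "v > 0"
  shows "m > 0"
proof -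
  define s where "s = 1 / (2 + J)"
  have "J \<ge> 0" using J[of undefined undefined] by linarith
  then have s: "0 < s" "s < 1" "s * J < 1" by (auto simp: s_def field_simps)
  have sj: "s * j x y < 1" for x y
    using mult_left_mono[of "j x y" J s] J[of x y] s by linarith
  obtain V where V: "\<And>x y. pmf (V x) y = pmf (W x) y * (1 - s * j x y)"
    by (rule tilted_channel[of W j s]) (use mean sj in auto)
  have D: "(\<Sum>y\<in>UNIV. pmf (V x) y * ln (pmf (V x) y / pmf q y)) \<le> m - s * v + s\<^sup>2 * v" for x
    using j mean var ac sj V
    by (rule tilted_channel_divergence_le[where j=j and W=W and q=q])
  have "0 \<le> m - s * v + s\<^sup>2 * v"
  proof -
    \<comment> \<open>Nonnegativity of divergence is the variational bound for one letter with
      \<open>f = 0\<close> and \<open>c = 1\<close>.\<close>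
    have "expect (channel_output V [undefined]) (\<lambda>_. 0)
      \<le> real (length [undefined :: 'x]) * (m - s * v + s\<^sup>2 * v) + ln 1 - 1
        + expect (channel_output (\<lambda>_. q) [undefined :: 'x]) (\<lambda>_. exp 0) / 1"
      by (rule expect_channel_output_le_divergence) (use ac D in \<open>auto simp: V\<close>)
    then show ?thesis by simp
  qed
  moreover have "s\<^sup>2 * v < s * v"
    using s v by (simp add: power2_eq_square)
  ultimately show ?thesis by linarith
qed

section \<open>Moderate deviations\<close>

text \<open>Here \<open>N\<close> is the block length, \<open>x\<close> is N^(-t), \<open>l\<close>
  is \<open>ln M\<close> and \<open>p\<close> a success probability. The code lies
  \<open>\<rho> * N * x\<close> below capacity, but \<open>N * D\<close> lies lower by a further
  \<open>d * \<rho> * N * x\<close>, up to \<open>N * g\<close>. If the claim failed, a quarter of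
  this surplus would cover the loss in \<open>p\<close>, a quarter the \<open>T - 1\<close> extra
  blocks, and less than half \<open>N * g\<close> and the two \<open>ln 2\<close>.\<close>

lemma success_le_of_rate_gap:
  fixes S T N D m d \<rho> x g l p :: real
  assumes main: "S * (l * p) \<le> (S + T - 1) * N * D + S * ln 2"
    and D: "D = m - (1 + d) * \<rho> * x + g" "D \<le> 2 * m"
    and S: "S > 0" "1 / S \<le> d * \<rho> * x / (8 * m * T)"
    and l: "l \<ge> N * m - \<rho> * (N * x) - ln 2" "N * m - \<rho> * (N * x) - ln 2 \<ge> 0"
    and x: "d * \<rho> / (4 * m) * x \<le> 1" "x \<ge> 0"
    and small: "N * g + 2 * ln 2 < d * \<rho> / 2 * (N * x)"
    and pos: "T \<ge> 1" "N > 0" "m > 0" "d > 0" "\<rho> > 0"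
  shows "p \<le> 1 - d * \<rho> / (4 * m) * x"
proof (rule ccontr)
  let ?c = "d * \<rho> / (4 * m)" and ?L = "N * m - \<rho> * (N * x) - ln 2"
  assume "\<not> ?thesis"
  then have p: "p \<ge> 1 - ?c * x" by simp
  have cx: "?c * x * (N * m) = d * \<rho> / 4 * (N * x)" using pos by simp
  have "?c * x \<ge> 0" using pos x by simp
  moreover have "?L \<le> N * m"
  proof -
    have "0 \<le> \<rho> * (N * x)" "0 \<le> ln (2 :: real)" using pos x by simp_all
    then show ?thesis by linarith
  qed
  ultimately have "?c * x * ?L \<le> ?c * x * (N * m)" by (rule mult_left_mono[rotated])
  then have "N * m - \<rho> * (N * x) - ln 2 - d * \<rho> / 4 * (N * x) \<le> ?L * (1 - ?c * x)"
    unfolding cx right_diff_distrib mult_1_right mult.commute[of ?L "?c * x"] by linarith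
  also have "\<dots> \<le> l * p"
    using l x p by (intro mult_mono) auto
  also have "l * p \<le> N * D + (T - 1) * (N * D) * (1 / S) + ln 2"
  proof -
    have "S * (l * p) \<le> S * (N * D + (T - 1) * (N * D) * (1 / S) + ln 2)"
      using main S by (simp add: algebra_simps)
    then show ?thesis using S by simp
  qed
  also have "(T - 1) * (N * D) * (1 / S) \<le> T * (N * (2 * m)) * (d * \<rho> * x / (8 * m * T))"
  proof -
    have "(T - 1) * (N * D) * (1 / S) \<le> (T - 1) * (N * (2 * m)) * (1 / S)"
      using pos D S by (intro mult_right_mono mult_left_mono) auto
    also have "\<dots> \<le> T * (N * (2 * m)) * (d * \<rho> * x / (8 * m * T))"
      using pos S by (intro mult_mono) auto
    finally show ?thesis .
  qed
  also have "T * (N * (2 * m)) * (d * \<rho> * x / (8 * m * T)) = d * \<rho> / 4 * (N * x)"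
    using pos by (simp add: field_simps)
  finally have "N * m - \<rho> * (N * x) - ln 2 - d * \<rho> / 4 * (N * x) \<le> N * D + d * \<rho> / 4 * (N * x) + ln 2"
    by simp
  also have "N * D = N * m - \<rho> * (N * x) - d * \<rho> * (N * x) + N * g"
    by (simp add: D algebra_simps)
  finally have "N * m - \<rho> * (N * x) - ln 2 - d * \<rho> * (N * x) / 4
    \<le> N * m - \<rho> * (N * x) - d * \<rho> * (N * x) + N * g + d * \<rho> * (N * x) / 4 + ln 2"
    by simp
  moreover have "N * g + 2 * ln 2 < d * \<rho> * (N * x) / 2" using small by simp
  ultimately show False by linarith
qed

text \<open>For \<open>b powr r \<ge> 2\<close> rounding to an adjacent integer loses at most a
  factor 2.\<close>

lemma log_size_ln_ge:
  assumes "b > 1" "log_size b M r" "ln b * r \<ge> ln 2"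
  shows "ln (real M) \<ge> ln b * r - ln 2"
proof -
  define R where "R = exp (ln b * r)"
  have powr: "b powr r = R"
    using assms(1) unfolding powr_def R_def mult.commute[of r] by simp
  have "exp (ln 2) \<le> R" unfolding R_def using assms(3) by (rule exp_mono)
  then have R: "R \<ge> 2" by simp
  have "\<bar>real M - R\<bar> < 1" using assms(2) unfolding log_size_def powr .
  then have M: "R / 2 \<le> real M" using R by linarith
  have "ln (R / 2) \<le> ln (real M)" by (rule ln_mono) (use M R in linarith)+
  moreover have "ln (R / 2) = ln b * r - ln 2" using R ln_div[of R 2] unfolding R_def by simp
  ultimately show ?thesis by simp
qed

theorem proposition2:
  fixes W :: "'x::finite \<Rightarrow> 'y::finite pmf"
    and b t :: real and T :: nat
    and M S :: "nat \<Rightarrow> nat" and \<epsilon> :: "nat \<Rightarrow> real"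
    and \<phi> :: "nat \<Rightarrow> nat \<Rightarrow> nat list \<Rightarrow> 'x list"
    and \<psi> :: "nat \<Rightarrow> nat \<Rightarrow> 'y list \<Rightarrow> nat"
  assumes "b > 1"
    and "output_symmetric W"
    and "dispersion b W > 0"
    and "T \<ge> 1"
    and "0 < t" and "t < 1 / 3"
    and "\<And>n. n \<ge> 1 \<Longrightarrow> streaming_code W n (M n) (\<epsilon> n) T (S n) (\<phi> n) (\<psi> n)"
    and "\<And>n. n \<ge> 1 \<Longrightarrow>
      log_size b (M n) (real n * capacity b W - real n powr (1 - t))"
    and "(\<lambda>n. real (S n)) \<in> \<omega>(\<lambda>n. real n powr t)"
  shows "limsup (\<lambda>n. neg_log b (\<epsilon> n) / ereal (real n powr (1 - 2 * t)))
    \<le> ereal (real T / (2 * dispersion b W) * log b (exp 1))"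
proof (rule output_symmetric_info_density[OF assms(1,2)])
  fix q j v
  assume ac: "\<And>x y. pmf q y = 0 \<Longrightarrow> pmf (W x) y = 0"
    and j': "\<And>x y. j x y = ln (pmf (W x) y / pmf q y) - ln b * capacity b W"
    and mean: "\<And>x. (\<Sum>y\<in>UNIV. pmf (W x) y * j x y) = 0"
    and var: "\<And>x. (\<Sum>y\<in>UNIV. pmf (W x) y * (j x y)\<^sup>2) = v"
    and disp': "dispersion b W \<le> v / (ln b)\<^sup>2"
  note code = assms(7) and size = assms(8) and S_omega = assms(9)
  note t = \<open>0 < t\<close> \<open>t < 1 / 3\<close>
  define \<rho> where "\<rho> = ln b"
  define m where "m = \<rho> * capacity b W"
  have \<rho>: "\<rho> > 0" using assms(1) by (simp add: \<rho>_def)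
  note j = j'[folded \<rho>_def, folded m_def] and disp = disp'[folded \<rho>_def]
  have "0 < v / \<rho>\<^sup>2" using disp assms(3) by linarith
  then have v: "v > 0" using \<rho> by (simp add: zero_less_divide_iff)
  define J where "J = Max (range (\<lambda>(x, y). \<bar>j x y\<bar>))"
  have J: "\<bar>j x y\<bar> \<le> J" for x y
    unfolding J_def by (intro Max_ge) auto
  have m: "m > 0" using ac j mean var J v by (rule info_mean_pos[where j=j and W=W and q=q])

  have upper: "\<forall>\<^sub>F n in sequentially. neg_log b (\<epsilon> n) / ereal (real n powr (1 - 2 * t)) \<le> ereal B"
    if B: "B > real T / (2 * dispersion b W) * log b (exp 1)" for B
  proof -
    \<comment> \<open>\<open>A\<close> is the exponent in nats with \<open>v\<close> in place of the
      dispersion. The gap between \<open>A\<close> and \<open>\<rho> * B\<close> leaves room for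
      five factors \<open>1 + d\<close>: two from the square of the enlarged tilt, two from the
      moment bound, and one that lets the threshold beat the moment.\<close>
    define A where "A = real T * \<rho>\<^sup>2 / (2 * v)"
    have "A = real T / (2 * (v / \<rho>\<^sup>2))" by (simp add: A_def)
    also have "\<dots> \<le> real T / (2 * dispersion b W)"
      using disp assms(3) v \<rho> by (intro divide_left_mono) auto
    also have "\<dots> < \<rho> * B"
      using B \<rho> assms(3) by (simp add: log_def \<rho>_def[symmetric] field_simps)
    finally have AB: "A < \<rho> * B" .
    have "((\<lambda>d. A * (1 + d) ^ 5) \<longlongrightarrow> A * (1 + 0) ^ 5) (at_right 0)"
      by (intro tendsto_intros)
    then have "\<forall>\<^sub>F d in at_right 0. A * (1 + d) ^ 5 < \<rho> * B"
      using AB by (intro order_tendstoD) auto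
    moreover have "\<forall>\<^sub>F d::real in at_right 0. d > 0"
      by (rule eventually_at_right_less)
    ultimately have "\<forall>\<^sub>F d in at_right 0. A * (1 + d) ^ 5 < \<rho> * B \<and> d > 0"
      by eventually_elim simp
    then obtain d where d: "A * (1 + d) ^ 5 < \<rho> * B" "d > 0"
      using eventually_happens[of _ "at_right (0::real)"] by auto
    obtain h where h: "0 < h" "h < 1"
      "\<And>u. \<bar>u\<bar> \<le> h \<Longrightarrow> (1 - u) powr (1 + d) \<le> 1 - (1 + d) * u + d * (1 + d)\<^sup>2 / 2 * u\<^sup>2"
      using one_minus_powr_upper_bound[OF d(2)] by blast
    \<comment> \<open>The tilt will be \<open>\<sigma>\<close> times n^(-t): its first-order effect
      on the divergence exceeds the rate gap by the factor \<open>1 + d\<close>. \<open>E\<close> is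
      the exponent of the likelihood threshold, \<open>c\<close> that of the tail beyond it,
      \<open>c0\<close> the coefficient of the forced error, and \<open>e\<close> the room left
      below \<open>\<rho> * B\<close>.\<close>
    define \<sigma> where "\<sigma> = (1 + d) * \<rho> / v"
    define c where "c = real T * d\<^sup>2 * (1 + d)\<^sup>2 * \<sigma>\<^sup>2 * v / 2"
    define E where "E = A * (1 + d) ^ 5"
    define c0 where "c0 = d * \<rho> / (4 * m)"
    define e where "e = \<rho> * B - E"
    have pos: "\<sigma> > 0" "c > 0" "c0 > 0" "e > 0"
      using d \<rho> v m assms(4) by (auto simp: \<sigma>_def c_def c0_def e_def E_def)
    have E_eq: "E = real T * (1 + d) ^ 3 * \<sigma>\<^sup>2 * v / 2"
      using v by (simp add: E_def A_def \<sigma>_def field_simps power2_eq_square eval_nat_numeral)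

    have "\<forall>\<^sub>F n in sequentially. real n * m - \<rho> * real n powr (1 - t) \<ge> ln 2"
      using m \<rho> t by real_asymp
    moreover have "\<forall>\<^sub>F n in sequentially. \<sigma> * J * real n powr (- t) \<le> h"
      using h(1) t by real_asymp
    moreover have "\<forall>\<^sub>F n in sequentially. \<sigma>\<^sup>2 * v * real n powr (- 2 * t) \<le> m"
      using m t by real_asymp
    moreover have "\<forall>\<^sub>F n in sequentially.
        \<sigma>\<^sup>2 * v * real n powr (1 - 2 * t) + 2 * ln 2 < d * \<rho> / 2 * real n powr (1 - t)"
      using d \<rho> t by real_asymp
    moreover have "\<forall>\<^sub>F n in sequentially. c0 * real n powr (- t) \<le> 1"
      using t by real_asymp
    \<comment> \<open>As 1 - 2t > 0, both exponentials vanish faster than n^(-t).\<close>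
    moreover have "\<forall>\<^sub>F n in sequentially.
        exp (- e * real n powr (1 - 2 * t)) \<le> c0 * real n powr (- t) - exp (- c * real n powr (1 - 2 * t))"
      using pos t by real_asymp
    moreover have "\<forall>\<^sub>F n in sequentially. real (S n) \<ge> 8 * m * real T / (d * \<rho>) * real n powr t"
    proof -
      have "8 * m * real T / (d * \<rho>) > 0" using d \<rho> m assms(4) by simp
      then show ?thesis
        using landau_omega.smallD[OF S_omega] by fastforce
    qed
    moreover have "\<forall>\<^sub>F n::nat in sequentially. n \<ge> 1" by (rule eventually_ge_at_top)
    ultimately show ?thesis
    proof eventually_elim
      case (elim n)
      define x where "x = real n powr (- t)"
      define N where "N = real n"
      have N: "N > 0" "n > 0" using elim(8) by (auto simp: N_def)
      have x: "x > 0" using N by (simp add: x_def)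
      have Nx: "real n powr (1 - t) = N * x" "real n powr (1 - 2 * t) = N * x\<^sup>2"
        "real n powr (- 2 * t) = x\<^sup>2" "real n powr t = 1 / x" "real n powr (- t) = x"
        using N by (auto simp: x_def N_def powr_diff powr_minus field_simps power2_eq_square
            powr_add[symmetric])
      note elim' = elim[unfolded Nx, folded N_def]
      define s where "s = \<sigma> * x"
      have s: "s > 0" using pos x by (simp add: s_def)
      have sj: "\<bar>s * j x' y\<bar> \<le> h" for x' y
      proof -
        have "\<bar>s * j x' y\<bar> \<le> s * J" using s J[of x' y] by (simp add: abs_mult)
        then show ?thesis using elim'(2) by (simp add: s_def mult_ac)
      qed
      then have sj1: "s * j x' y < 1" for x' y using h(2) sj[of x' y] by linarith
      obtain V where V: "\<And>x y. pmf (V x) y = pmf (W x) y * (1 - s * j x y)"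
        by (rule tilted_channel[of W j s]) (use mean sj1 in auto)
      define D where "D = m - s * v + s\<^sup>2 * v"
      define K where "K = exp (d * (1 + d)\<^sup>2 * (s\<^sup>2 * v / 2))"
      define \<Lambda> where "\<Lambda> = exp (E * (N * x\<^sup>2))"
      \<comment> \<open>The threshold carries (1 + d)^3 and the moment (1 + d)^2; their difference d
        * (1 + d)^2 leaves the decay rate \<open>c\<close>.\<close>
      have tau: "\<Lambda> powr (- d) * K ^ (T * n) = exp (- c * (N * x\<^sup>2))"
        unfolding K_def \<Lambda>_def exp_of_nat_mult[symmetric] powr_def
        by (simp add: exp_add[symmetric] E_eq c_def s_def N_def field_simps power2_eq_square eval_nat_numeral)
      have *: "real (S n) * (ln (real (M n)) * (1 - \<Lambda> * \<epsilon> n - \<Lambda> powr (- d) * K ^ (T * n)))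
        \<le> real ((S n + T - 1) * n) * D + real (S n) * ln 2"
      proof (rule streaming_converse[OF code[OF elim(8)], where q=q and V=V])
        show "(\<Sum>y\<in>UNIV. pmf (V x) y * ln (pmf (V x) y / pmf q y)) \<le> D" for x
          unfolding D_def using j mean var ac sj1 V
            by (rule tilted_channel_divergence_le[where j=j and W=W and q=q])
        show "(\<Sum>y\<in>UNIV. pmf (V x) y * (pmf (V x) y / pmf (W x) y) powr d) \<le> K" for x
          unfolding K_def using mean var sj h(2,3) V
            by (rule tilted_channel_moment_le[where j=j and W=W])
      qed (use ac d in \<open>auto simp: V \<Lambda>_def\<close>)
      have "1 - \<Lambda> * \<epsilon> n - exp (- c * (N * x\<^sup>2)) \<le> 1 - d * \<rho> / (4 * m) * x"
      proof (rule success_le_of_rate_gap)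
        show "real (S n) * (ln (real (M n)) * (1 - \<Lambda> * \<epsilon> n - exp (- c * (N * x\<^sup>2))))
          \<le> (real (S n) + real T - 1) * N * D + real (S n) * ln 2"
          using * assms(4) unfolding tau by (simp add: N_def of_nat_diff)
        show "D = m - (1 + d) * \<rho> * x + \<sigma>\<^sup>2 * v * x\<^sup>2"
          using v by (simp add: D_def s_def \<sigma>_def power_mult_distrib power_divide)
        have "s * v > 0" using s v by simp
        then show "D \<le> 2 * m"
          using elim'(3) by (simp add: D_def s_def power_mult_distrib mult_ac)
        have S': "8 * m * real T / (d * \<rho> * x) \<le> real (S n)" 
          using elim'(7) by (simp add: field_simps)
        have P: "8 * m * real T / (d * \<rho> * x) > 0" using m d \<rho> x assms(4) by simp
        show "real (S n) > 0" using S' P by linarith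
        have "1 / real (S n) \<le> 1 / (8 * m * real T / (d * \<rho> * x))"
          by (rule frac_le[OF zero_le_one order_refl P S'])
        then show "1 / real (S n) \<le> d * \<rho> * x / (8 * m * real T)" by simp
        show "N * m - \<rho> * (N * x) - ln 2 \<ge> 0" using elim'(1) by simp
        have r: "ln b * (N * capacity b W - N * x) = N * m - \<rho> * (N * x)"
          by (simp add: m_def \<rho>_def algebra_simps)
        have "log_size b (M n) (N * capacity b W - N * x)"
          using size[OF elim(8)] by (simp add: Nx(1) N_def)
        from log_size_ln_ge[OF assms(1) this] show "ln (real (M n)) \<ge> N * m - \<rho> * (N * x) - ln 2"
          unfolding r using elim'(1) by simp
        show "d * \<rho> / (4 * m) * x \<le> 1" using elim'(5) by (simp add: c0_def)
        show "N * (\<sigma>\<^sup>2 * v * x\<^sup>2) + 2 * ln 2 < d * \<rho> / 2 * (N * x)"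
          using elim'(4) by (simp add: mult_ac)
      qed (use x N m d \<rho> assms(4) in auto)
      \<comment> \<open>The forced error \<open>c0 * x\<close>, less the likelihood tail, is only
        polynomially small. Replacing it by a weak exponential of rate \<open>e\<close> makes the
        total exponent \<open>E + e = \<rho> * B\<close>.\<close>
      then have "exp (- e * (N * x\<^sup>2)) \<le> \<Lambda> * \<epsilon> n"
        using elim'(6) by (simp add: c0_def)
      then have "exp (- e * (N * x\<^sup>2)) / \<Lambda> \<le> \<epsilon> n"
        by (simp add: \<Lambda>_def divide_le_eq mult.commute)
      then have eps: "exp (- (\<rho> * B) * (N * x\<^sup>2)) \<le> \<epsilon> n"
        by (simp add: \<Lambda>_def e_def exp_diff[symmetric] algebra_simps)
      \<comment> \<open>This excludes the infinite value of \<open>neg_log\<close>.\<close>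
      have eps0: "\<epsilon> n > 0" using eps by (rule less_le_trans[rotated]) simp
      have Nx2: "0 < N * x\<^sup>2" using N x by simp
      have "ln (exp (- (\<rho> * B) * (N * x\<^sup>2))) \<le> ln (\<epsilon> n)"
        using eps eps0 by (subst ln_le_cancel_iff) auto
      then have "- ln (\<epsilon> n) \<le> B * (N * x\<^sup>2) * \<rho>"
        by (simp add: mult_ac)
      then have "- ln (\<epsilon> n) / \<rho> \<le> B * (N * x\<^sup>2)"
        by (simp only: pos_divide_le_eq[OF \<rho>])
      then have "- log b (\<epsilon> n) \<le> B * (N * x\<^sup>2)"
        by (simp add: log_def \<rho>_def)
      then have "- log b (\<epsilon> n) / (N * x\<^sup>2) \<le> B"
        by (simp only: pos_divide_le_eq[OF Nx2])
      then show ?case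
        using eps0 N x unfolding Nx neg_log_def by simp
    qed
  qed
  show ?thesis
  proof (rule ereal_le_epsilon2)
    fix e :: real assume "e > 0"
    then have "limsup (\<lambda>n. neg_log b (\<epsilon> n) / ereal (real n powr (1 - 2 * t)))
      \<le> ereal (real T / (2 * dispersion b W) * log b (exp 1) + e)"
      by (intro Limsup_bounded upper) simp
    then show "limsup (\<lambda>n. neg_log b (\<epsilon> n) / ereal (real n powr (1 - 2 * t)))
      \<le> ereal (real T / (2 * dispersion b W) * log b (exp 1)) + ereal e" by simp
  qed
qed

end
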